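(* Let $m=2n$. Consider a deck of $m$ cards labeled $1,\dots,m$ from top to bottom, and the following random procedure. Step 1: choose $j\in\{0,1,\dots,n\}$ with probability $\binom{2n}{2j}/2^{2n-1}$; form a second pile of size $2j$ by removing the top $j$ cards of the deck and then putting the bottom $j$ cards of the deck (in their order) on top of them; the remaining $2n-2j$ middle cards form the first pile. Step 2: choose uniformly at random one of the $\binom{2n}{2j}$ interleavings of the two piles preserving the relative order within each pile. Encode the resulting deck as $\sigma\in S_m$ where $\sigma(i)$ is the label of the card in position $i$. Then for every $\sigma\in S_m$ the probability that the procedure yields $\sigma$ equals $x_2(\sigma^{-1})$. The same holds for $m=2n+1$, with $j\in\{0,\dots,n\}$ chosen with probability $\binom{2n+1}{2j}/2^{2n}$ and the first pile having $2n+1-2j$ cards.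
   Context: For $w\in S_m$, $x_2(w)$ is $2^{-(m-1)}$ times the number of integer vectors $(v_1,\dots,v_m)$ with $v_1+\dots+v_m=0$, $v_1\ge\dots\ge v_m$, $v_1-v_m\le 2$, $v_i>v_{i+1}$ whenever $w(i)>w(i+1)$ ($1\le i\le m-1$), and $v_1<v_m+2$ if $w(m)>w(1)$ (the type $A_{m-1}$ affine $2$-shuffle). *)

theory Defs
  imports "HOL-Probability.Probability" "HOL-Combinatorics.Combinatorics"
begin

text \<open>
  A vector \<open>(v\<^sub>1, \<dots>, v\<^sub>m)\<close> is an extensional function on \<open>{1..m}\<close>, and an element of \<open>S\<^sub>m\<close> is
  a function \<open>w\<close> on the natural numbers with \<open>w permutes {1..m}\<close>.
\<close>

definition affine2_vectors :: "nat \<Rightarrow> (nat \<Rightarrow> nat) \<Rightarrow> (nat \<Rightarrow> int) set" where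
  "affine2_vectors m w = {v \<in> {1..m} \<rightarrow>\<^sub>E UNIV.
     (\<Sum>i=1..m. v i) = 0 \<and>
     (\<forall>i\<in>{1..<m}. v i \<ge> v (i + 1)) \<and>
     v 1 - v m \<le> 2 \<and>
     (\<forall>i\<in>{1..<m}. w i > w (i + 1) \<longrightarrow> v i > v (i + 1)) \<and>
     (w m > w 1 \<longrightarrow> v 1 < v m + 2)}"

definition x2 :: "nat \<Rightarrow> (nat \<Rightarrow> nat) \<Rightarrow> real" where
  "x2 m w = real (card (affine2_vectors m w)) / 2 ^ (m - 1)"

lemma finite_affine2_vectors: "finite (affine2_vectors m w)"
proof (cases "m = 0")
  case True
  then have "affine2_vectors m w \<subseteq> {1..m} \<rightarrow>\<^sub>E {}"
    by (auto simp: affine2_vectors_def)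
  then show ?thesis
    using True by (simp add: finite_subset)
next
  case False
  have "affine2_vectors m w \<subseteq> {1..m} \<rightarrow>\<^sub>E {-2..2}"
  proof
    fix v assume v: "v \<in> affine2_vectors m w"
    have E: "v \<in> {1..m} \<rightarrow>\<^sub>E UNIV" and s: "(\<Sum>i=1..m. v i) = 0"
      and d: "\<And>i. i \<in> {1..<m} \<Longrightarrow> v i \<ge> v (i + 1)" and b: "v 1 - v m \<le> 2"
      using v by (auto simp: affine2_vectors_def)
    have mono: "v k \<le> v i" if "i \<le> k" "1 \<le> i" "k \<le> m" for i k
      using that
    proof (induction k rule: dec_induct)
      case (step k)
      then show ?case using d[of k] by simp
    qed simp
    have "v 1 \<ge> 0"
    proof (rule ccontr)
      assume "\<not> v 1 \<ge> 0"
      then have "\<And>i. i \<in> {1..m} \<Longrightarrow> v i < 0" using mono[of 1] by fastforce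
      then have "(\<Sum>i=1..m. v i) < (\<Sum>i=1..m. 0)"
        using False by (intro sum_strict_mono) auto
      with s show False by simp
    qed
    moreover have "v m \<le> 0"
    proof (rule ccontr)
      assume "\<not> v m \<le> 0"
      then have "\<And>i. i \<in> {1..m} \<Longrightarrow> 0 < v i" using mono[of _ m] by fastforce
      then have "(\<Sum>i=1..m. 0) < (\<Sum>i=1..m. v i)"
        using False by (intro sum_strict_mono) auto
      with s show False by simp
    qed
    ultimately have "v i \<in> {-2..2}" if "i \<in> {1..m}" for i
      using mono[of 1 i] mono[of i m] that b by auto
    with E show "v \<in> {1..m} \<rightarrow>\<^sub>E {-2..2}" by (auto simp: PiE_iff)
  qed
  then show ?thesis
    by (rule finite_subset) (simp add: finite_PiE)
qed

definition pile_index_pmf :: "nat \<Rightarrow> nat pmf" where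
  "pile_index_pmf m =
     embed_pmf (\<lambda>j. if j \<le> m div 2 then real (m choose (2 * j)) / 2 ^ (m - 1) else 0)"

lemma sum_choose_even:
  assumes "m \<ge> 1"
  shows "(\<Sum>j\<le>m div 2. real (m choose (2 * j))) = 2 ^ (m - 1)"
proof -
  have inj: "inj_on (\<lambda>j::nat. 2 * j) {..m div 2}"
    by (auto simp: inj_on_def)
  have img: "(\<lambda>j::nat. 2 * j) ` {..m div 2} = {i \<in> {..m}. even i}"
    by (auto elim!: evenE)
  have "(\<Sum>j\<le>m div 2. real (m choose (2 * j))) = (\<Sum>i | i \<le> m \<and> even i. real (m choose i))"
    using sum.reindex[OF inj, of "\<lambda>i. real (m choose i)"] img by (simp add: o_def)
  also have "\<dots> = (\<Sum>i\<le>m. if even i then real (m choose i) else 0)"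
    by (subst sum.inter_filter[symmetric]) auto
  also have "\<dots> = 2 ^ m / 2"
    using choose_even_sum[of m, where 'a = real] assms by simp
  also have "\<dots> = 2 ^ (m - 1)"
    using assms by (simp add: power_diff)
  finally show ?thesis .
qed

lemma pmf_pile_index_pmf:
  assumes "m \<ge> 1"
  shows "pmf (pile_index_pmf m) j =
    (if j \<le> m div 2 then real (m choose (2 * j)) / 2 ^ (m - 1) else 0)"
  unfolding pile_index_pmf_def
proof (rule pmf_embed_pmf)
  let ?f = "\<lambda>j. if j \<le> m div 2 then real (m choose (2 * j)) / 2 ^ (m - 1) else 0"
  have "(\<integral>\<^sup>+ j. ennreal (?f j) \<partial>count_space UNIV) = (\<Sum>j\<le>m div 2. ennreal (?f j))"
    by (rule nn_integral_count_space') auto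
  also have "\<dots> = ennreal (\<Sum>j\<le>m div 2. real (m choose (2 * j)) / 2 ^ (m - 1))"
    by (subst sum_ennreal[symmetric]) auto
  also have "\<dots> = 1"
    using sum_choose_even[OF assms] by (simp flip: sum_divide_distrib)
  finally show "(\<integral>\<^sup>+ j. ennreal (?f j) \<partial>count_space UNIV) = 1" .
qed auto

text \<open>Decks and piles are lists, read from top to bottom.\<close>

definition initial_deck :: "nat \<Rightarrow> nat list" where
  "initial_deck m = [1..<m + 1]"

definition first_pile :: "nat \<Rightarrow> nat list \<Rightarrow> nat list" where
  "first_pile j d = drop j (take (length d - j) d)"

definition second_pile :: "nat \<Rightarrow> nat list \<Rightarrow> nat list" where
  "second_pile j d = drop (length d - j) d @ take j d"

definition affine2_shuffle_deck :: "nat \<Rightarrow> nat list pmf" where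
  "affine2_shuffle_deck m = do {
     j \<leftarrow> pile_index_pmf m;
     pmf_of_set (shuffles (first_pile j (initial_deck m)) (second_pile j (initial_deck m)))
   }"

text \<open>
  The set \<open>shuffles\<close> contains each resulting deck once; as the two piles share no label, distinct
  interleavings give distinct decks, so the uniform choice is among \<open>m choose (2 * j)\<close> decks.
\<close>

lemma card_shuffles_piles:
  assumes "2 * j \<le> m"
  shows "card (shuffles (first_pile j (initial_deck m)) (second_pile j (initial_deck m))) =
    m choose (2 * j)"
proof -
  let ?d = "initial_deck m"
  have len: "length (first_pile j ?d) = m - 2 * j" "length (second_pile j ?d) = 2 * j"
    using assms by (auto simp: first_pile_def second_pile_def initial_deck_def)
  have "set (first_pile j ?d) \<inter> set (second_pile j ?d) = {}"
    using assms by (auto simp: first_pile_def second_pile_def initial_deck_def take_upt drop_upt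
        simp del: upt_Suc)
  from card_disjoint_shuffles[OF this] show ?thesis
    using assms by (simp add: len binomial_symmetric[of "2 * j" m])
qed

definition deck_perm :: "nat list \<Rightarrow> nat \<Rightarrow> nat" where
  "deck_perm d i = (if i \<in> {1..length d} then d ! (i - 1) else i)"

definition affine2_shuffle :: "nat \<Rightarrow> (nat \<Rightarrow> nat) pmf" where
  "affine2_shuffle m = map_pmf deck_perm (affine2_shuffle_deck m)"

end

theory Submission
  imports Defs
begin

text \<open>
  A nonincreasing integer vector with sum \<open>0\<close> and \<open>v\<^sub>1 - v\<^sub>m \<le> 2\<close> consists of \<open>j\<close> ones, then
  \<open>m - 2j\<close> zeros, then \<open>j\<close> minus ones, so it is determined by some \<open>j \<le> m div 2\<close>. The descent conditions
  say that \<open>w = inv \<sigma>\<close> increases on each of the three blocks and, when \<open>j > 0\<close>, that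
  \<open>w m < w 1\<close>; since \<open>w\<close> gives the position of a label, this means precisely that the deck \<open>\<sigma>\<close>
  interleaves the two piles of the procedure with parameter \<open>j\<close>. Each such \<open>j\<close> contributes
  \<open>1 / 2\<^sup>m\<^sup>-\<^sup>1\<close> to the probability of \<open>\<sigma>\<close>, the two binomial coefficients cancelling.
\<close>

section \<open>Interleavings and increasing position functions\<close>

text \<open>A list with strictly increasing \<open>w\<close>-values is determined by its set of
  entries. Hence filtering \<open>d\<close> to the entries of a pile returns that pile exactly when
  the pile is itself \<open>w\<close>-increasing.\<close>

lemma mem_shuffles_iff_increasing:
  fixes w :: "'a \<Rightarrow> 'b::linorder"
  assumes w: "inj w" and d: "sorted_wrt (<) (map w d)"
    and disj: "set xs \<inter> set ys = {}" and set: "set d = set xs \<union> set ys"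
  shows "d \<in> shuffles xs ys \<longleftrightarrow> sorted_wrt (<) (map w xs) \<and> sorted_wrt (<) (map w ys)"
    (is "_ \<longleftrightarrow> ?R")
proof
  have filt: "sorted_wrt (<) (map w (filter P d))" for P
    using d by (simp add: sorted_wrt_map sorted_wrt_filter)
  show ?R if "d \<in> shuffles xs ys"
    using filt[of "\<lambda>x. x \<in> set xs"] filt[of "\<lambda>x. x \<notin> set xs"]
    by (simp add: filter_shuffles_disjoint1[OF disj that])
  have eq: "filter (\<lambda>x. x \<in> set zs) d = zs"
    if "sorted_wrt (<) (map w zs)" "set zs \<subseteq> set d" for zs
  proof -
    have "map w (filter (\<lambda>x. x \<in> set zs) d) = map w zs"
      using filt that by (intro strict_sorted_equal) auto
    then show ?thesis using w by (simp add: inj_map_eq_map)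
  qed
  assume R: ?R
  have "filter (\<lambda>x. x \<notin> set xs) d = filter (\<lambda>x. x \<in> set ys) d"
    using disj set by (intro filter_cong) auto
  then show "d \<in> shuffles xs ys"
    using partition_in_shuffles[of d "\<lambda>x. x \<in> set xs"] eq[of xs] eq[of ys] R set by simp
qed

text \<open>By transitivity a single comparison at the junction controls all pairs across it. In the
  second pile that comparison is \<open>w m < w 1\<close>.\<close>

lemma sorted_wrt_append_iff:
  assumes "transp P"
  shows "sorted_wrt P (xs @ ys) \<longleftrightarrow> sorted_wrt P xs \<and> sorted_wrt P ys \<and>
    (xs = [] \<or> ys = [] \<or> P (last xs) (hd ys))"
  using assms by (simp add: successively_append_iff flip: successively_conv_sorted_wrt)

lemma strict_sorted_map_upt_iff:
  fixes w :: "nat \<Rightarrow> 'a::linorder"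
  shows "sorted_wrt (<) (map w [a..<b]) \<longleftrightarrow> (\<forall>i. a \<le> i \<and> Suc i < b \<longrightarrow> w i < w (Suc i))"
proof
  show "\<forall>i. a \<le> i \<and> Suc i < b \<longrightarrow> w i < w (Suc i)" if "sorted_wrt (<) (map w [a..<b])"
  proof (intro allI impI)
    fix i assume i: "a \<le> i \<and> Suc i < b"
    then have "i - a < Suc i - a" "Suc i - a < b - a" by arith+
    then show "w i < w (Suc i)"
      using sorted_wrt_nth_less[OF that, of "i - a" "Suc i - a"] i by simp
  qed
  assume "\<forall>i. a \<le> i \<and> Suc i < b \<longrightarrow> w i < w (Suc i)"
  then show "sorted_wrt (<) (map w [a..<b])"
    by (simp add: sorted_wrt_iff_nth_Suc_transp)
qed

lemma first_pile_initial_deck: "first_pile j (initial_deck m) = [j + 1..<m - j + 1]"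
  by (cases "j \<le> m") (simp_all add: first_pile_def initial_deck_def take_upt drop_upt del: upt_Suc)

text \<open>Read cyclically, this pile is one run of consecutive labels passing from
  \<open>m\<close> to 1, which is why an affine (cyclic) descent enters.\<close>

lemma second_pile_initial_deck:
  assumes "2 * j \<le> m"
  shows "second_pile j (initial_deck m) = [m - j + 1..<m + 1] @ [1..<j + 1]"
  using assms by (simp add: second_pile_def initial_deck_def take_upt drop_upt del: upt_Suc)

lemma set_piles_disjoint:
  assumes "2 * j \<le> m"
  shows "set (first_pile j (initial_deck m)) \<inter> set (second_pile j (initial_deck m)) = {}"
  unfolding first_pile_initial_deck second_pile_initial_deck[OF assms] by auto

lemma set_piles_Un:
  assumes "2 * j \<le> m"
  shows "set (first_pile j (initial_deck m)) \<union> set (second_pile j (initial_deck m)) = {1..m}"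
  unfolding first_pile_initial_deck second_pile_initial_deck[OF assms] using assms by auto

section \<open>Classification of the vectors counted by \<open>x2\<close>\<close>

text \<open>For \<open>2 * j \<le> m\<close> the values are 1 up to \<open>j\<close>, 0 up to
  \<open>m - j\<close> and -1 afterwards. Writing them with two indicators reduces the sum of the
  entries to two counts of initial segments.\<close>

definition balanced_vector :: "nat \<Rightarrow> nat \<Rightarrow> nat \<Rightarrow> int" where
  "balanced_vector m j = (\<lambda>i\<in>{1..m}. of_bool (i \<le> j) + of_bool (i \<le> m - j) - 1)"

lemma inj_on_balanced_vector: "inj_on (balanced_vector m) {..m div 2}"
proof (rule linorder_inj_onI)
  fix j k assume jk: "j < k" "j \<in> {..m div 2}" "k \<in> {..m div 2}"
  \<comment> \<open>At index \<open>k\<close> the vector for \<open>j\<close> is 0, since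
    \<open>j < k \<le> m - j\<close>, while the vector for \<open>k\<close> is 1.\<close>
  then have "balanced_vector m j k \<noteq> balanced_vector m k k"
    by (auto simp: balanced_vector_def)
  then show "balanced_vector m j \<noteq> balanced_vector m k" by auto
qed auto

lemma sum_of_bool_le:
  fixes k m :: nat
  assumes "k \<le> m"
  shows "(\<Sum>i=1..m. of_bool (i \<le> k) :: int) = int k"
proof -
  have "{i \<in> {1..m}. i \<le> k} = {1..k}" using assms by auto
  then show ?thesis by (simp add: sum_of_bool_eq Int_def)
qed

lemma downward_closed_eq_atLeastAtMost:
  fixes A :: "nat set"
  assumes sub: "A \<subseteq> {1..m}" and down: "\<And>i k. k \<in> A \<Longrightarrow> 1 \<le> i \<Longrightarrow> i \<le> k \<Longrightarrow> i \<in> A"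
  shows "A = {1..card A}"
proof (cases "A = {}")
  case False
  have fin: "finite A" using sub by (rule finite_subset) simp
  have "A = {1..Max A}"
    using sub down[OF Max_in[OF fin False]] Max_ge[OF fin] by fastforce
  then show ?thesis by (metis card_atLeastAtMost diff_Suc_1 plus_1_eq_Suc add.commute)
qed simp

text \<open>Monotonicity, zero sum and spread at most 2 confine the entries to -1, 0, 1. The indices
  with value 1 and those with value at least 0 form initial segments, of lengths \<open>j\<close>
  and \<open>c\<close>, which determine the vector.\<close>

lemma affine2_vectors_subset_balanced:
  assumes m: "m \<ge> 1"
  shows "affine2_vectors m w \<subseteq> balanced_vector m ` {..m div 2}"
proof
  fix v assume v: "v \<in> affine2_vectors m w"
  have E: "v \<in> {1..m} \<rightarrow>\<^sub>E UNIV" and s: "(\<Sum>i=1..m. v i) = 0"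
    and d: "\<And>i. i \<in> {1..<m} \<Longrightarrow> v i \<ge> v (i + 1)" and b: "v 1 - v m \<le> 2"
    using v by (auto simp: affine2_vectors_def)
  have mono: "v k \<le> v i" if "i \<le> k" "1 \<le> i" "k \<le> m" for i k
    using that
  proof (induction k rule: dec_induct)
    case (step k)
    then show ?case using d[of k] by simp
  qed simp
  have "v 1 \<le> 1"
  proof (rule ccontr)
    assume *: "\<not> v 1 \<le> 1"
    \<comment> \<open>If \<open>v 1\<close> is at least 2, the spread bound makes the last entry,
      hence every entry, nonnegative, so the sum is at least \<open>v 1\<close> and cannot
      vanish.\<close>
    then have "\<And>i. i \<in> {1..m} \<Longrightarrow> 0 \<le> v i" using mono[of _ m] b by fastforce
    then have "v 1 \<le> (\<Sum>i=1..m. v i)" using m by (intro member_le_sum) auto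
    with s * show False by simp
  qed
  moreover have "v m \<ge> -1"
  proof (rule ccontr)
    assume *: "\<not> v m \<ge> -1"
    then have "\<And>i. i \<in> {1..m} \<Longrightarrow> 0 \<le> - v i" using mono[of 1] b by fastforce
    then have "- v m \<le> (\<Sum>i=1..m. - v i)" using m by (intro member_le_sum) auto
    with s * show False by (simp add: sum_negf)
  qed
  ultimately have range: "-1 \<le> v i" "v i \<le> 1" if "i \<in> {1..m}" for i
    using mono[of 1 i] mono[of i m] that by auto
  define A where "A = {i \<in> {1..m}. v i = 1}"
  define C where "C = {i \<in> {1..m}. v i \<ge> 0}"
  define j where "j = card A"
  define c where "c = card C"
  have A: "A = {1..j}" unfolding j_def
  proof (rule downward_closed_eq_atLeastAtMost)
    show "i \<in> A" if "k \<in> A" "1 \<le> i" "i \<le> k" for i k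
      using that mono[of i k] range(2)[of i] by (auto simp: A_def)
  qed (auto simp: A_def)
  have C: "C = {1..c}" unfolding c_def
  proof (rule downward_closed_eq_atLeastAtMost)
    show "i \<in> C" if "k \<in> C" "1 \<le> i" "i \<le> k" for i k
      using that mono[of i k] by (auto simp: C_def)
  qed (auto simp: C_def)
  have sub: "A \<subseteq> C" "C \<subseteq> {1..m}" by (auto simp: A_def C_def)
  have le: "j \<le> c" "c \<le> m"
    using card_mono[OF _ sub(1)] card_mono[OF _ sub(2)] by (auto simp: C_def j_def c_def)
  have veq: "v i = of_bool (i \<le> j) + of_bool (i \<le> c) - 1" if "i \<in> {1..m}" for i
  proof -
    have "i \<in> A \<longleftrightarrow> i \<le> j" "i \<in> C \<longleftrightarrow> i \<le> c" using that by (simp_all add: A C)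
    moreover have "i \<in> A \<longleftrightarrow> v i = 1" "i \<in> C \<longleftrightarrow> v i \<ge> 0"
      using that by (simp_all add: A_def C_def)
    ultimately show ?thesis using range[OF that] by auto
  qed
  have "(\<Sum>i=1..m. v i) = (\<Sum>i=1..m. of_bool (i \<le> j) + of_bool (i \<le> c) - 1)"
    using veq by (intro sum.cong) auto
  also have "\<dots> = int j + int (c) - int m"
    using le sum_of_bool_le[of j m] sum_of_bool_le[of c m]
    by (simp add: sum_subtractf sum.distrib)
  \<comment> \<open>Zero sum means that the \<open>m - c\<close> entries -1 balance the
    \<open>j\<close> entries 1.\<close>
  finally have c: "c = m - j" using s le by linarith
  have "v = balanced_vector m j"
  proof (rule PiE_ext[OF E])
    show "balanced_vector m j \<in> {1..m} \<rightarrow>\<^sub>E UNIV" by (simp add: balanced_vector_def)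
    show "v i = balanced_vector m j i" if "i \<in> {1..m}" for i
      using veq[OF that] that by (simp add: balanced_vector_def c)
  qed
  moreover have "j \<le> m div 2" using le c by auto
  ultimately show "v \<in> balanced_vector m ` {..m div 2}" by auto
qed

text \<open>The vector drops strictly only after \<open>j\<close> and after \<open>m - j\<close>, so
  \<open>w\<close> may descend only there. What remains is that \<open>w\<close> ascends inside each
  block, together with the cyclic condition, which joins the last block to the first.\<close>

lemma balanced_vector_mem_affine2_vectors_iff:
  assumes m: "m \<ge> 1" and j: "2 * j \<le> m" and w: "inj w"
  shows "balanced_vector m j \<in> affine2_vectors m w \<longleftrightarrow>
    sorted_wrt (<) (map w (first_pile j (initial_deck m))) \<and>
    sorted_wrt (<) (map w (second_pile j (initial_deck m)))"
    (is "_ \<longleftrightarrow> ?F \<and> ?S")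
proof -
  let ?v = "balanced_vector m j"
  have neq: "\<not> w i > w (Suc i) \<longleftrightarrow> w i < w (Suc i)" for i
    using w by (metis injD n_not_Suc_n not_less_iff_gr_or_eq)
  have vi: "?v i = of_bool (i \<le> j) + of_bool (i \<le> m - j) - 1" if "i \<in> {1..m}" for i
    using that by (simp add: balanced_vector_def)
  have E: "?v \<in> {1..m} \<rightarrow>\<^sub>E UNIV" by (simp add: balanced_vector_def)
  have "(\<Sum>i=1..m. ?v i) = (\<Sum>i=1..m. of_bool (i \<le> j) + of_bool (i \<le> m - j) - 1)"
    using vi by (intro sum.cong) auto
  also have "\<dots> = 0"
    using j sum_of_bool_le[of j m] sum_of_bool_le[of "m - j" m]
    by (simp add: sum_subtractf sum.distrib)
  finally have s: "(\<Sum>i=1..m. ?v i) = 0" .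
  have dec: "\<forall>i\<in>{1..<m}. ?v i \<ge> ?v (i + 1)" using vi by auto
  have width: "?v 1 - ?v m = (if j = 0 then 0 else 2)" using m j vi by auto
  \<comment> \<open>For \<open>j = 0\<close> neither index lies in the range; for
    \<open>2 * j = m\<close> the two coincide in one drop of size 2.\<close>
  have eq: "?v i > ?v (Suc i) \<longleftrightarrow> i = j \<or> i = m - j" if "i \<in> {1..<m}" for i
    using that j vi by (auto simp: of_bool_def)
  have F: "?F \<longleftrightarrow> (\<forall>i. j < i \<and> i < m - j \<longrightarrow> w i < w (Suc i))"
    unfolding first_pile_initial_deck strict_sorted_map_upt_iff by auto
  have S: "?S \<longleftrightarrow> (\<forall>i. m - j < i \<and> i < m \<longrightarrow> w i < w (Suc i)) \<and>
      (\<forall>i. 1 \<le> i \<and> i < j \<longrightarrow> w i < w (Suc i)) \<and> (j = 0 \<or> w m < w 1)"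
    unfolding second_pile_initial_deck[OF j] map_append sorted_wrt_append_iff[OF transp_on_less]
      strict_sorted_map_upt_iff
    using j by (cases "j = 0") (auto simp: last_map hd_map last_upt Suc_le_eq simp del: upt_Suc)
  have desc: "(\<forall>i\<in>{1..<m}. w i > w (i + 1) \<longrightarrow> ?v i > ?v (i + 1)) \<longleftrightarrow>
      (\<forall>i\<in>{1..<m}. i \<noteq> j \<and> i \<noteq> m - j \<longrightarrow> w i < w (Suc i))"
    using neq eq by auto
  \<comment> \<open>For positive \<open>j\<close> the spread is exactly 2, so the strict bound fails
    and \<open>w m > w 1\<close> must be excluded. Moreover \<open>m \<ge> 2\<close> in that case,
    so injectivity rules out equality.\<close>
  have cyc: "(w m > w 1 \<longrightarrow> ?v 1 < ?v m + 2) \<longleftrightarrow> j = 0 \<or> w m < w 1"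
  proof (cases "j = 0")
    case False
    then have "w m \<noteq> w 1" using j by (auto dest: injD[OF w])
    then show ?thesis using width False by auto
  qed (use width in auto)
  have blocks: "i \<in> {1..<m} \<and> i \<noteq> j \<and> i \<noteq> m - j \<longleftrightarrow>
      (j < i \<and> i < m - j) \<or> (m - j < i \<and> i < m) \<or> (1 \<le> i \<and> i < j)" for i
    using j by auto
  have "?v \<in> affine2_vectors m w \<longleftrightarrow>
      (\<forall>i\<in>{1..<m}. i \<noteq> j \<and> i \<noteq> m - j \<longrightarrow> w i < w (Suc i)) \<and> (j = 0 \<or> w m < w 1)"
    using E s dec width desc cyc by (simp add: affine2_vectors_def)
  also have "\<dots> \<longleftrightarrow> ?F \<and> ?S"
    unfolding F S using blocks by blast
  finally show ?thesis .
qed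

section \<open>The law of the shuffle\<close>

lemma shuffles_piles_nonempty:
  assumes "2 * j \<le> m"
  shows "shuffles (first_pile j (initial_deck m)) (second_pile j (initial_deck m)) \<noteq> {}"
  using card_shuffles_piles[OF assms] assms by (metis card.empty zero_less_binomial less_irrefl)

text \<open>\<open>deck_perm\<close> extends by the identity, so decks of different lengths can
  encode the same permutation. Fixing the length on the support makes the encoding injective
  there.\<close>

lemma length_deck:
  assumes "m \<ge> 1" and "d \<in> set_pmf (affine2_shuffle_deck m)"
  shows "length d = m"
proof -
  obtain j where j: "j \<in> set_pmf (pile_index_pmf m)" and
    d: "d \<in> set_pmf (pmf_of_set (shuffles (first_pile j (initial_deck m))
      (second_pile j (initial_deck m))))"
    using assms(2) by (auto simp: affine2_shuffle_deck_def)
  have j': "2 * j \<le> m"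
    using j assms(1) by (auto simp: set_pmf_iff pmf_pile_index_pmf split: if_splits)
  have "d \<in> shuffles (first_pile j (initial_deck m)) (second_pile j (initial_deck m))"
    using d shuffles_piles_nonempty[OF j'] by simp
  then show ?thesis
    using j' by (auto dest!: length_shuffles
        simp: first_pile_initial_deck second_pile_initial_deck simp del: upt_Suc)
qed

lemma deck_perm_eq_iff:
  assumes "\<sigma> permutes {1..length d}"
  shows "deck_perm d = \<sigma> \<longleftrightarrow> d = map \<sigma> [1..<length d + 1]"
proof
  show "d = map \<sigma> [1..<length d + 1]" if "deck_perm d = \<sigma>"
    by (rule nth_equalityI) (auto simp flip: that simp: deck_perm_def simp del: upt_Suc)
  assume d: "d = map \<sigma> [1..<length d + 1]"
  show "deck_perm d = \<sigma>"
  proof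
    fix i
    show "deck_perm d i = \<sigma> i"
    proof (cases "i \<in> {1..length d}")
      case True
      then have "map \<sigma> [1..<length d + 1] ! (i - 1) = \<sigma> i"
        by (subst nth_map_upt) auto
      then have "d ! (i - 1) = \<sigma> i" by (simp only: d[symmetric])
      then show ?thesis using True by (simp add: deck_perm_def)
    next
      case False
      then show ?thesis using permutes_not_in[OF assms] by (auto simp: deck_perm_def)
    qed
  qed
qed

lemma pmf_affine2_shuffle:
  assumes m: "m \<ge> 1" and \<sigma>: "\<sigma> permutes {1..m}"
  shows "pmf (affine2_shuffle m) \<sigma> = pmf (affine2_shuffle_deck m) (map \<sigma> [1..<m + 1])"
proof -
  let ?D = "affine2_shuffle_deck m"
  have "pmf (affine2_shuffle m) \<sigma> = measure_pmf.prob ?D (deck_perm -` {\<sigma>})"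
    by (simp add: affine2_shuffle_def pmf_map)
  also have "\<dots> = measure_pmf.prob ?D {map \<sigma> [1..<m + 1]}"
    using length_deck[OF m] deck_perm_eq_iff \<sigma>
    \<comment> \<open>The two events need to agree only on decks of positive probability, all of
      which have length \<open>m\<close>.\<close>
    by (intro measure_prob_cong_0) (auto simp: set_pmf_iff simp del: upt_Suc)
  finally show ?thesis by (simp add: measure_pmf_single del: upt_Suc)
qed

lemma pmf_affine2_shuffle_deck:
  assumes "m \<ge> 1"
  shows "pmf (affine2_shuffle_deck m) d = real (card {j \<in> {..m div 2}.
    d \<in> shuffles (first_pile j (initial_deck m)) (second_pile j (initial_deck m))}) / 2 ^ (m - 1)"
proof -
  let ?S = "\<lambda>j. shuffles (first_pile j (initial_deck m)) (second_pile j (initial_deck m))"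
  have "pmf (affine2_shuffle_deck m) d =
      (\<Sum>j\<le>m div 2. pmf (pmf_of_set (?S j)) d * pmf (pile_index_pmf m) j)"
    \<comment> \<open>The integral over \<open>j\<close> becomes a finite sum because the law of
      \<open>j\<close> vanishes beyond \<open>m div 2\<close>.\<close>
    unfolding affine2_shuffle_deck_def pmf_bind
    by (rule integral_measure_pmf_real)
      (auto simp: set_pmf_iff pmf_pile_index_pmf[OF assms] split: if_splits)
  also have "\<dots> = (\<Sum>j\<le>m div 2. of_bool (d \<in> ?S j) / 2 ^ (m - 1))"
    by (intro sum.cong)
      (auto simp: pmf_pile_index_pmf[OF assms] card_shuffles_piles shuffles_piles_nonempty indicator_def)
  also have "\<dots> = real (card {j \<in> {..m div 2}. d \<in> ?S j}) / 2 ^ (m - 1)"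
    by (simp add: sum_of_bool_eq Int_def flip: sum_divide_distrib)
  finally show ?thesis .
qed

lemma pmf_affine2_shuffle_eq_x2:
  assumes m: "m \<ge> 1" and \<sigma>: "\<sigma> permutes {1..m}"
  shows "pmf (affine2_shuffle m) \<sigma> = x2 m (inv \<sigma>)"
proof -
  let ?w = "inv \<sigma>" and ?d = "map \<sigma> [1..<m + 1]"
  let ?J = "{j \<in> {..m div 2}. ?d \<in> shuffles (first_pile j (initial_deck m))
    (second_pile j (initial_deck m))}"
  have inj: "inj ?w" using permutes_inv[OF \<sigma>] by (rule permutes_inj)
  \<comment> \<open>Applied to the deck, the inverse permutation lists the positions in order, so
    the deck is \<open>?w\<close>-increasing as the interleaving criterion demands.\<close>
  have "map ?w ?d = [1..<m + 1]"
    using permutes_inverses(2)[OF \<sigma>] by (simp add: map_idI del: upt_Suc)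
  then have sorted: "sorted_wrt (<) (map ?w ?d)" by (simp only: sorted_wrt_upt)
  have set: "set ?d = {1..m}"
    using permutes_image[OF \<sigma>] by (simp add: atLeastLessThanSuc_atLeastAtMost del: upt_Suc)
  have "balanced_vector m j \<in> affine2_vectors m ?w \<longleftrightarrow> j \<in> ?J" if "j \<in> {..m div 2}" for j
  proof -
    have j: "2 * j \<le> m" using that by auto
    show ?thesis
      using that balanced_vector_mem_affine2_vectors_iff[OF m j inj]
        mem_shuffles_iff_increasing[OF inj sorted set_piles_disjoint[OF j]]
        set set_piles_Un[OF j] by simp
  qed
  then have "affine2_vectors m ?w = balanced_vector m ` ?J"
    using affine2_vectors_subset_balanced[OF m, of ?w] by blast
  moreover have "inj_on (balanced_vector m) ?J"
    by (rule inj_on_subset[OF inj_on_balanced_vector]) auto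
  ultimately have "card (affine2_vectors m ?w) = card ?J" by (simp add: card_image)
  then show ?thesis
    by (simp only: pmf_affine2_shuffle[OF m \<sigma>] pmf_affine2_shuffle_deck[OF m] x2_def)
qed

theorem theorem3:
  fixes n :: nat
  shows "(n \<ge> 1 \<longrightarrow> (\<forall>\<sigma>. \<sigma> permutes {1..2 * n} \<longrightarrow>
            pmf (affine2_shuffle (2 * n)) \<sigma> = x2 (2 * n) (inv \<sigma>))) \<and>
         (\<forall>\<sigma>. \<sigma> permutes {1..2 * n + 1} \<longrightarrow>
            pmf (affine2_shuffle (2 * n + 1)) \<sigma> = x2 (2 * n + 1) (inv \<sigma>))"
  by (intro conjI impI allI pmf_affine2_shuffle_eq_x2) auto

end
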